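(* Let $A$ be a finite, nonempty subset of an abelian group. If $A$ is sum-full, then $A$ is not zero-sum-free; that is, if every element of $A$ is representable as a sum of two elements of $A$ (possibly equal to each other), then there is a nonempty subset $S\subseteq A$ with $\sum_{s\in S}s=0$.
   Context: Abelian groups are written additively. A subset $A$ of an abelian group is called sum-full if every element of $A$ is a sum of two elements of $A$, possibly equal to each other; that is, if $A\subseteq 2A$, where $2A=\{a+b : a,b\in A\}$. A finite subset is zero-sum if the sum of its (distinct) elements is equal to $0$. A subset is zero-sum-free if it does not contain a nonempty zero-sum subset (the set itself being allowed as a subset). *)

theory Defs
  imports Main "HOL-Library.Set_Algebras"
begin

text \<open>The sum \<open>A + A\<close> is the pointwise sum of sets from \<^theory>\<open>HOL-Library.Set_Algebras\<close>,
  so the two summands may coincide.\<close>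

definition sum_full :: "'a::ab_group_add set \<Rightarrow> bool"
  where "sum_full A \<longleftrightarrow> A \<subseteq> A + A"

definition zero_sum :: "'a::ab_group_add set \<Rightarrow> bool"
  where "zero_sum S \<longleftrightarrow> finite S \<and> \<Sum>S = 0"

definition zero_sum_free :: "'a::ab_group_add set \<Rightarrow> bool"
  where "zero_sum_free A \<longleftrightarrow> \<not> (\<exists>S. S \<subseteq> A \<and> S \<noteq> {} \<and> zero_sum S)"

end

theory Submission
  imports Defs "HOL-Library.Multiset" "HOL-Library.FuncSet"
begin

text \<open>
  Choose for every \<open>a \<in> A\<close> a representation \<open>a = f a + g a\<close> with \<open>f a, g a \<in> A\<close>, and read it as
  two arcs from \<open>a\<close> to \<open>f a\<close> and to \<open>g a\<close>, in a digraph on \<open>A\<close> in which loops and double arcs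
  may occur. Adding up the representations of the elements of a set \<open>X \<subseteq> A\<close> shows that the heads of
  the arcs that leave \<open>X\<close>, counted with multiplicity, have the same sum as \<open>X\<close>. If the
  multiset of these heads is the sum of \<open>X\<close> and of a second set \<open>S\<close>, which may overlap \<open>X\<close>, then
  \<open>S\<close> is zero-sum; and \<open>|S| = 2 |X| - |X| > 0\<close> if \<open>X \<noteq> {}\<close>. Such a nonempty \<open>X\<close> exists for purely
  combinatorial reasons, in every nonempty finite digraph in which all out-degrees are 2 (lemma
  \<open>selection_exists\<close>).

  This is an induction on the number of vertices. The in-degrees have average 2, so there are three
  cases. A vertex of in-degree 0 can be deleted, because no arc is lost except its own. If all
  in-degrees are at least 2, they are all equal to 2, and \<open>X = S\<close> can be the set of all vertices.
  The remaining case is a vertex \<open>q\<close> with a single incoming arc, say from \<open>v\<close>; let \<open>p\<close> be the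
  other out-neighbour of \<open>v\<close>. Contract \<open>v\<close> into \<open>p\<close>: delete \<open>v\<close> and redirect to \<open>p\<close> all arcs that
  point to \<open>v\<close>. A solution of the smaller digraph lifts (lemma \<open>selection_lift\<close>), with \<open>v\<close> put back
  into \<open>X\<close> just when redirected arcs are in use: then the arc from \<open>v\<close> to \<open>p\<close> takes over the place
  of one of them, and the arc from \<open>v\<close> to \<open>q\<close> does no harm since nothing else can hit \<open>q\<close>.
\<close>

definition heads :: "('v \<Rightarrow> 'v) \<Rightarrow> ('v \<Rightarrow> 'v) \<Rightarrow> 'v set \<Rightarrow> 'v multiset"
  where "heads f g X = image_mset f (mset_set X) + image_mset g (mset_set X)"

lemma set_mset_heads: "finite X \<Longrightarrow> set_mset (heads f g X) = f ` X \<union> g ` X"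
  by (simp add: heads_def)

lemma size_heads: "size (heads f g X) = 2 * card X"
  by (simp add: heads_def)

lemma heads_commute: "heads f g X = heads g f X"
  by (simp add: heads_def add.commute)

lemma heads_insert:
  "finite X \<Longrightarrow> v \<notin> X \<Longrightarrow> heads f g (insert v X) = {#f v, g v#} + heads f g X"
  by (simp add: heads_def)

text \<open>
  The equation says that a vertex of \<open>X\<close> is hit once or twice from \<open>X\<close>, and any other vertex at most
  once; \<open>S\<close> collects the surplus hits. As an equation of multisets it can be summed in a group.
\<close>

definition selection :: "('v \<Rightarrow> 'v) \<Rightarrow> ('v \<Rightarrow> 'v) \<Rightarrow> 'v set \<Rightarrow> 'v set \<Rightarrow> 'v set \<Rightarrow> bool"
  where "selection f g V X S \<longleftrightarrow>
    X \<subseteq> V \<and> S \<subseteq> V \<and> X \<noteq> {} \<and> heads f g X = mset_set X + mset_set S"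

lemma selection_commute: "selection f g V X S \<longleftrightarrow> selection g f V X S"
  by (simp add: selection_def heads_commute[of f])

lemma selection_mono: "selection f g W X S \<Longrightarrow> W \<subseteq> V \<Longrightarrow> selection f g V X S"
  by (auto simp: selection_def)

text \<open>
  The lifting step of the contraction of \<open>v\<close> into \<open>g v\<close>. Let \<open>k\<close> be the number of arcs from \<open>X\<close> that
  point to \<open>v\<close> before the contraction. They are among the hits of \<open>g v\<close> after it, hence \<open>k \<le> 2\<close>. If
  \<open>k = 0\<close>, nothing changes. Otherwise \<open>v\<close> joins \<open>X\<close>, whereby \<open>g v\<close> loses \<open>k\<close> hits and gains one,
  and \<open>f v\<close> is hit for the first time, so that it joins \<open>S\<close>. If \<open>k = 2\<close>, both \<open>v\<close> and \<open>g v\<close> are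
  adjusted in \<open>S\<close>: the surplus hit of \<open>g v\<close> is now a surplus hit of \<open>v\<close>.
\<close>

lemma selection_lift:
  fixes f g :: "'v \<Rightarrow> 'v"
  assumes "finite V" and "v \<in> V"
    and V: "f v \<in> V" "g v \<in> V"
    and unshared: "f v \<notin> f ` (V - {v}) \<union> g ` (V - {v})"
    and neq: "f v \<noteq> v" "g v \<noteq> v" "f v \<noteq> g v"
    and merge: "m = id(v := g v)"
    and sel: "selection (m \<circ> f) (m \<circ> g) (V - {v}) X S"
  shows "\<exists>X S. selection f g V X S"
proof -
  have X: "X \<subseteq> V - {v}" "X \<noteq> {}" and S: "S \<subseteq> V - {v}"
    and eq: "heads (m \<circ> f) (m \<circ> g) X = mset_set X + mset_set S"
    using sel by (auto simp: selection_def)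
  have fin: "finite X" "finite S"
    using X S \<open>finite V\<close> by (auto intro: finite_subset)
  define M where "M = heads f g X"
  define k where "k = count M v"
  have "heads (m \<circ> f) (m \<circ> g) X = image_mset m M"
    by (simp add: heads_def M_def multiset.map_comp comp_def)
  also have "M = filter_mset (\<lambda>x. x \<noteq> v) M + replicate_mset k v"
    by (rule multiset_eqI) (simp add: k_def)
  also have "image_mset m \<dots> = filter_mset (\<lambda>x. x \<noteq> v) M + replicate_mset k (g v)"
  proof -
    have "image_mset m (filter_mset (\<lambda>x. x \<noteq> v) M) = image_mset id (filter_mset (\<lambda>x. x \<noteq> v) M)"
      by (rule image_mset_cong) (simp add: merge)
    then show ?thesis by (simp add: merge)
  qed
  finally have "filter_mset (\<lambda>x. x \<noteq> v) M + replicate_mset k (g v) = mset_set X + mset_set S"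
    unfolding eq by (rule sym)
  then have counts: "count (filter_mset (\<lambda>x. x \<noteq> v) M + replicate_mset k (g v)) b
      = count (mset_set X + mset_set S) b" for b
    by simp
  then have M: "count M b + (if b = g v then k else 0) = of_bool (b \<in> X) + of_bool (b \<in> S)"
    if "b \<noteq> v" for b
    using counts[of b] that fin by (auto simp: count_mset_set')
  have "f v \<notin># M"
    using unshared X fin by (auto simp: M_def set_mset_heads)
  then have "count M (f v) = 0"
    by (simp add: not_in_iff)
  then have q: "f v \<notin> X" "f v \<notin> S"
    using M[of "f v"] neq by (auto split: if_splits)
  have "v \<notin> X" "v \<notin> S" using X S by auto
  have k_le: "k \<le> of_bool (g v \<in> X) + of_bool (g v \<in> S)"
    using M[of "g v"] neq by simp
  consider "k = 0" | "k = 1" | "k = 2" "g v \<in> S"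
    using k_le by (cases "g v \<in> X"; cases "g v \<in> S"; force)
  then show ?thesis
  proof cases
    case 1
    have "M = mset_set X + mset_set S"
    proof (rule multiset_eqI)
      fix b show "count M b = count (mset_set X + mset_set S) b"
        using M[of b] 1 fin \<open>v \<notin> X\<close> \<open>v \<notin> S\<close>
        by (cases "b = v") (auto simp: k_def count_mset_set' split: if_splits)
    qed
    then show ?thesis
      using X S by (intro exI[of _ X] exI[of _ S]) (auto simp: selection_def M_def)
  next
    case 2
    have "heads f g (insert v X) = mset_set (insert v X) + mset_set (insert (f v) S)"
    proof (rule multiset_eqI)
      fix b show "count (heads f g (insert v X)) b
          = count (mset_set (insert v X) + mset_set (insert (f v) S)) b"
        using M[of b] 2 fin \<open>v \<notin> X\<close> \<open>v \<notin> S\<close> q neq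
        by (cases "b = v") (auto simp: heads_insert k_def count_mset_set' simp flip: M_def)
    qed
    then show ?thesis
      using X S V \<open>v \<in> V\<close> by (intro exI[of _ "insert v X"] exI[of _ "insert (f v) S"]) (auto simp: selection_def)
  next
    case 3
    let ?S = "insert v (insert (f v) (S - {g v}))"
    have "heads f g (insert v X) = mset_set (insert v X) + mset_set ?S"
    proof (rule multiset_eqI)
      fix b show "count (heads f g (insert v X)) b = count (mset_set (insert v X) + mset_set ?S) b"
        using M[of b] 3 fin \<open>v \<notin> X\<close> \<open>v \<notin> S\<close> q neq
        by (cases "b = v") (auto simp: heads_insert k_def count_mset_set' simp flip: M_def)
    qed
    then show ?thesis
      using X S V \<open>v \<in> V\<close> by (intro exI[of _ "insert v X"] exI[of _ ?S]) (auto simp: selection_def)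
  qed
qed

text \<open>
  The induction step at the vertex \<open>f v\<close> of in-degree 1. A loop at \<open>v\<close> excludes the contraction, but
  then \<open>X = {v}\<close> is a solution by itself, with the head of the other arc as surplus.
\<close>

lemma selection_step:
  fixes f g :: "'v \<Rightarrow> 'v"
  assumes "finite V" and "v \<in> V"
    and maps: "f \<in> V \<rightarrow> V" "g \<in> V \<rightarrow> V"
    and single: "count (heads f g V) (f v) = 1"
    and smaller: "\<And>f g. f \<in> V - {v} \<rightarrow> V - {v} \<Longrightarrow> g \<in> V - {v} \<rightarrow> V - {v} \<Longrightarrow> V - {v} \<noteq> {}
      \<Longrightarrow> \<exists>X S. selection f g (V - {v}) X S"
  shows "\<exists>X S. selection f g V X S"
proof -
  have V: "f v \<in> V" "g v \<in> V" using maps \<open>v \<in> V\<close> by auto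
  have "heads f g V = {#f v, g v#} + heads f g (V - {v})"
    using heads_insert[of "V - {v}" v f g] assms(1,2) by (simp add: insert_absorb)
  then have "g v \<noteq> f v" and "f v \<notin># heads f g (V - {v})"
    using single by (auto simp: not_in_iff split: if_splits)
  then have unshared: "f v \<notin> f ` (V - {v}) \<union> g ` (V - {v})"
    using \<open>finite V\<close> by (simp add: set_mset_heads)
  consider "f v = v" | "g v = v" | "f v \<noteq> v" "g v \<noteq> v" by blast
  then show ?thesis
  proof cases
    case 1
    then have "selection f g V {v} {g v}"
      using V by (simp add: selection_def heads_def)
    then show ?thesis by blast
  next
    case 2
    then have "selection f g V {v} {f v}"
      using V by (simp add: selection_def heads_def)
    then show ?thesis by blast
  next
    case 3
    define m where "m = id(v := g v)"
    have "m \<circ> f \<in> V - {v} \<rightarrow> V - {v}" "m \<circ> g \<in> V - {v} \<rightarrow> V - {v}"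
      using maps V 3 by (auto simp: m_def Pi_iff)
    moreover have "V - {v} \<noteq> {}" using V 3 by blast
    ultimately obtain X S where "selection (m \<circ> f) (m \<circ> g) (V - {v}) X S"
      using smaller by blast
    then show ?thesis
      using selection_lift[OF assms(1,2) V unshared 3 _ m_def] \<open>g v \<noteq> f v\<close> by metis
  qed
qed

lemma selection_exists:
  fixes f g :: "'v \<Rightarrow> 'v"
  assumes "finite V" and "V \<noteq> {}" and "f \<in> V \<rightarrow> V" and "g \<in> V \<rightarrow> V"
  shows "\<exists>X S. selection f g V X S"
  using assms
proof (induction V arbitrary: f g rule: finite_psubset_induct)
  case (psubset V)
  have IH: "\<exists>X S. selection f g (V - {v}) X S"
    if "v \<in> V" "f \<in> V - {v} \<rightarrow> V - {v}" "g \<in> V - {v} \<rightarrow> V - {v}" "V - {v} \<noteq> {}" for v f g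
    using psubset.IH[of "V - {v}" f g] that by blast
  consider (none) q where "q \<in> V" "count (heads f g V) q = 0"
    | (one) q where "q \<in> V" "count (heads f g V) q = 1"
    | (more) "\<And>q. q \<in> V \<Longrightarrow> count (heads f g V) q \<ge> 2"
    by (metis One_nat_def less_2_cases not_le)
  then show ?case
  proof cases
    case none
    then have "q \<notin> f ` V \<union> g ` V"
      using \<open>finite V\<close> by (simp add: set_mset_heads flip: not_in_iff)
    then have "f \<in> V - {q} \<rightarrow> V - {q}" "g \<in> V - {q} \<rightarrow> V - {q}" "V - {q} \<noteq> {}"
      using psubset.prems by fastforce+
    then show ?thesis
      using IH[OF \<open>q \<in> V\<close>] selection_mono by (metis Diff_subset)
  next
    case one
    then have "q \<in># heads f g V"
      by (simp flip: count_greater_zero_iff)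
    then obtain v where "v \<in> V" "f v = q \<or> g v = q"
      using \<open>finite V\<close> by (auto simp: set_mset_heads)
    then show ?thesis
    proof (elim disjE)
      assume "f v = q"
      then show ?thesis
        using selection_step[of V v f g] IH one psubset \<open>v \<in> V\<close> by blast
    next
      assume "g v = q"
      then have "\<exists>X S. selection g f V X S"
        using selection_step[of V v g f] IH one psubset \<open>v \<in> V\<close>
        by (metis heads_commute)
      then show ?thesis
        by (simp add: selection_commute[of f])
    qed
  next
    case more
    \<comment> \<open>There are only \<open>2 * card V\<close> arcs, so the lower bound 2 is attained at every vertex.\<close>
    have "mset_set V + mset_set V \<subseteq># heads f g V"
      using more \<open>finite V\<close> by (intro mset_subset_eqI) (auto simp: count_mset_set' numeral_2_eq_2)
    then have "heads f g V = mset_set V + mset_set V"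
      by (metis mset_subset_size mult_2 nat_neq_iff size_heads size_mset_set size_union
          subset_mset.le_neq_trans)
    then have "selection f g V V V"
      using \<open>V \<noteq> {}\<close> by (simp add: selection_def)
    then show ?thesis by blast
  qed
qed

theorem theorem1:
  fixes A :: "'a::ab_group_add set"
  assumes "finite A" and "A \<noteq> {}" and "sum_full A"
  shows "\<not> zero_sum_free A"
proof -
  have "\<forall>a\<in>A. \<exists>b c. b \<in> A \<and> c \<in> A \<and> a = b + c"
    using \<open>sum_full A\<close> unfolding sum_full_def by (blast elim: set_plus_elim)
  then obtain f g where fg: "f \<in> A \<rightarrow> A" "g \<in> A \<rightarrow> A"
    and split: "\<And>a. a \<in> A \<Longrightarrow> a = f a + g a"
    by (metis Pi_I)
  obtain X S where X: "X \<subseteq> A" "X \<noteq> {}" and S: "S \<subseteq> A"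
    and eq: "heads f g X = mset_set X + mset_set S"
    using selection_exists[OF assms(1,2) fg] by (auto simp: selection_def)
  have fin: "finite X" "finite S"
    using X S \<open>finite A\<close> by (auto intro: finite_subset)
  have "2 * card X = card X + card S"
    using arg_cong[OF eq, of size] by (simp add: size_heads)
  then have "S \<noteq> {}"
    using X fin by auto
  have "\<Sum>X = (\<Sum>a\<in>X. f a + g a)"
    using split X by (intro sum.cong) auto
  also have "\<dots> = \<Sum>\<^sub># (heads f g X)"
    unfolding sum.distrib by (simp add: heads_def sum_unfold_sum_mset)
  also have "\<dots> = \<Sum>X + \<Sum>S"
    by (simp add: eq sum_unfold_sum_mset)
  finally have "zero_sum S"
    using fin by (simp add: zero_sum_def)
  then show ?thesis
    using S \<open>S \<noteq> {}\<close> by (auto simp: zero_sum_free_def)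
qed

end
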